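(* Let $\Gamma$ be an embedded network with Hamiltonian $\mathcal H=\{H_\gamma\}_{\gamma\in\mathcal E}$ as in the context, let $c$ be its critical value and let $a\in\mathbb R$. If the equation $\mathcal H(x,Du)=a$ on $\Gamma$ admits solutions, then $a=c$.
   Context: **Network.** Fix a dimension $N$. $\mathcal E$ is a finite collection of arcs, i.e. regular ($C^1$ on $[0,1]$, with one-sided derivatives at the endpoints, and non-vanishing derivative) simple oriented curves $\gamma:[0,1]\to\mathbb R^N$ (loops, $\gamma(0)=\gamma(1)$, are allowed), such that for each $\gamma\in\mathcal E$ the inverse arc $\widetilde\gamma(s):=\gamma(1-s)$ also belongs to $\mathcal E$, and $\gamma((0,1))\cap\gamma'([0,1])=\emptyset$ whenever $\gamma'\in\mathcal E$, $\gamma'\ne\gamma,\widetilde\gamma$. The embedded network is $\Gamma=\bigcup_{\gamma\in\mathcal E}\gamma([0,1])\subset\mathbb R^N$. The set $\mathbf V$ of vertices consists of all initial and terminal points of arcs. $\Gamma$ is assumed connected: any two vertices are linked by a finite concatenation of arcs. For $x\in\mathbf V$, $\Gamma_x:=\{\gamma\in\mathcal E:\gamma(1)=x\}$. **Hamiltonian.** $\mathcal H=\{H_\gamma\}_{\gamma\in\mathcal E}$ with $H_\gamma:[0,1]\times\mathbb R\to\mathbb R$ satisfying $H_{\widetilde\gamma}(s,\mu)=H_\gamma(1-s,-\mu)$; otherwise the $H_\gamma$ are unrelated. Each $H_\gamma$ is continuous in both arguments, coercive in $\mu$, and strictly quasiconvex in $\mu$: $H_\gamma(s,\rho\mu+(1-\rho)\mu')<\max\{H_\gamma(s,\mu),H_\gamma(s,\mu')\}$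 for all $s\in[0,1]$, $\mu\ne\mu'$ in $\mathbb R$, $\rho\in(0,1)$. **Equation and solutions.** For $a\in\mathbb R$, $\mathcal H(x,Du)=a$ on $\Gamma$ denotes the family of equations $H_\gamma(s,\partial U)=a$ on $[0,1]$, $\gamma\in\mathcal E$, understood in the viscosity sense. A continuous $w:\Gamma\to\mathbb R$ is a subsolution if $w\circ\gamma$ is a viscosity subsolution of $H_\gamma(s,\partial U)=a$ in $(0,1)$ for every $\gamma\in\mathcal E$. A continuous $v:\Gamma\to\mathbb R$ is a supersolution if (1) $v\circ\gamma$ is a viscosity supersolution of $H_\gamma(s,\partial U)=a$ in $(0,1)$ for every $\gamma\in\mathcal E$, and (2) for every vertex $x$ there is at least one arc $\gamma\in\Gamma_x$ such that $H_\gamma(1,\partial\varphi(1))\ge a$ for every constrained $C^1$ subtangent $\varphi$ to $v\circ\gamma$ at $1$, i.e. every $C^1$ function $\varphi$ such that $1$ is a minimizer of $v\circ\gamma-\varphi$ in a neighborhood of $1$ intersected with $[0,1]$. A solution is a continuous function that is both a sub- and a supersolution. **Critical value.** $a_\gamma:=\max_{s\in[0,1]}\min_{\mu\in\mathbb R}H_\gamma(s,\mu)$, $a_0:=\max_{\gamma\in\mathcal E}a_\gamma$, and $c:=\inf\{a\ge a_0:\mathcal H(x,Du)=a\text{ admits subsolutions}\}$ (finite). *)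

theory Defs
  imports "HOL-Analysis.Analysis"
begin

text \<open>
  Arcs are total functions on the reals of which only the values on \<open>[0,1]\<close> matter. A loop,
  \<open>\<gamma> 0 = \<gamma> 1\<close>, is a \<^const>\<open>simple_path\<close>, whereas it is not an \<^const>\<open>arc\<close> in the sense of
  the library. \<^const>\<open>C1_differentiable_on\<close> asks for two-sided derivatives, so it is not used here.
\<close>

definition regular_arc :: "(real \<Rightarrow> real ^ 'n) \<Rightarrow> bool" where
  "regular_arc \<gamma> \<longleftrightarrow> simple_path \<gamma> \<and>
     (\<exists>D. continuous_on {0..1} D \<and>
          (\<forall>s\<in>{0..1}. (\<gamma> has_vector_derivative D s) (at s within {0..1}) \<and> D s \<noteq> 0))"

definition vertices :: "(real \<Rightarrow> real ^ 'n) set \<Rightarrow> (real ^ 'n) set" where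
  "vertices \<E> = pathstart ` \<E> \<union> pathfinish ` \<E>"

definition network_space :: "(real \<Rightarrow> real ^ 'n) set \<Rightarrow> (real ^ 'n) set" where
  "network_space \<E> = (\<Union>\<gamma>\<in>\<E>. path_image \<gamma>)"

definition arcs_into :: "(real \<Rightarrow> real ^ 'n) set \<Rightarrow> real ^ 'n \<Rightarrow> (real \<Rightarrow> real ^ 'n) set" where
  "arcs_into \<E> x = {\<gamma>\<in>\<E>. pathfinish \<gamma> = x}"

text \<open>
  The disjointness condition is stated for distinct functions on the reals. Since it is violated by
  two arcs with the same image, neither of which is the inverse of the other, it forces members of
  \<open>\<E>\<close> that agree on \<open>[0,1]\<close> to be equal; so comparing total functions amounts to
  comparing arcs on \<open>[0,1]\<close>. Nonemptiness of \<open>\<E>\<close> is implicit in taking a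
  maximum over \<open>\<E>\<close> in the definition of the critical value.
\<close>

definition embedded_network :: "(real \<Rightarrow> real ^ 'n) set \<Rightarrow> bool" where
  "embedded_network \<E> \<longleftrightarrow>
     finite \<E> \<and> \<E> \<noteq> {} \<and>
     (\<forall>\<gamma>\<in>\<E>. regular_arc \<gamma>) \<and>
     (\<forall>\<gamma>\<in>\<E>. reversepath \<gamma> \<in> \<E>) \<and>
     (\<forall>\<gamma>\<in>\<E>. \<forall>\<gamma>'\<in>\<E>. \<gamma>' \<noteq> \<gamma> \<and> \<gamma>' \<noteq> reversepath \<gamma> \<longrightarrow>
        \<gamma> ` {0<..<1} \<inter> path_image \<gamma>' = {}) \<and>
     (\<forall>x\<in>vertices \<E>. \<forall>y\<in>vertices \<E>.
        (x, y) \<in> {(pathstart \<gamma>, pathfinish \<gamma>) |\<gamma>. \<gamma> \<in> \<E>}\<^sup>+)"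

text \<open>
  Coercivity is pointwise in \<open>s\<close>; by continuity and quasiconvexity it is then uniform on
  \<open>[0,1]\<close>.
\<close>

definition hamiltonian_on ::
  "(real \<Rightarrow> real ^ 'n) set \<Rightarrow> ((real \<Rightarrow> real ^ 'n) \<Rightarrow> real \<Rightarrow> real \<Rightarrow> real) \<Rightarrow> bool" where
  "hamiltonian_on \<E> H \<longleftrightarrow> (\<forall>\<gamma>\<in>\<E>.
     (\<forall>s\<in>{0..1}. \<forall>\<mu>. H (reversepath \<gamma>) s \<mu> = H \<gamma> (1 - s) (- \<mu>)) \<and>
     continuous_on ({0..1} \<times> UNIV) (\<lambda>(s, \<mu>). H \<gamma> s \<mu>) \<and>
     (\<forall>s\<in>{0..1}. filterlim (H \<gamma> s) at_top at_infinity) \<and>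
     (\<forall>s\<in>{0..1}. \<forall>\<mu> \<mu>'. \<forall>\<rho>\<in>{0<..<1}. \<mu> \<noteq> \<mu>' \<longrightarrow>
        H \<gamma> s (\<rho> * \<mu> + (1 - \<rho>) * \<mu>') < max (H \<gamma> s \<mu>) (H \<gamma> s \<mu>')))"

text \<open>
  Test functions are \<open>C\<^sup>1\<close> on the whole line; being \<open>C\<^sup>1\<close> only near the point
  of tangency, or near it from the left at the endpoint \<open>1\<close>, gives the same test slopes.
\<close>

definition supertangent :: "(real \<Rightarrow> real) \<Rightarrow> (real \<Rightarrow> real) \<Rightarrow> real \<Rightarrow> bool" where
  "supertangent \<phi> u s \<longleftrightarrow> \<phi> C1_differentiable_on UNIV \<and>
     (\<forall>\<^sub>F t in nhds s. u t - \<phi> t \<le> u s - \<phi> s)"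

definition subtangent :: "(real \<Rightarrow> real) \<Rightarrow> (real \<Rightarrow> real) \<Rightarrow> real \<Rightarrow> bool" where
  "subtangent \<phi> u s \<longleftrightarrow> \<phi> C1_differentiable_on UNIV \<and>
     (\<forall>\<^sub>F t in nhds s. u s - \<phi> s \<le> u t - \<phi> t)"

definition constrained_subtangent :: "(real \<Rightarrow> real) \<Rightarrow> (real \<Rightarrow> real) \<Rightarrow> real \<Rightarrow> bool" where
  "constrained_subtangent \<phi> u s \<longleftrightarrow> \<phi> C1_differentiable_on UNIV \<and>
     (\<forall>\<^sub>F t in nhds s. t \<in> {0..1} \<longrightarrow> u s - \<phi> s \<le> u t - \<phi> t)"

definition arc_subsolution :: "(real \<Rightarrow> real \<Rightarrow> real) \<Rightarrow> real \<Rightarrow> (real \<Rightarrow> real) \<Rightarrow> bool" where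
  "arc_subsolution h a u \<longleftrightarrow>
     (\<forall>s\<in>{0<..<1}. \<forall>\<phi>. supertangent \<phi> u s \<longrightarrow> h s (deriv \<phi> s) \<le> a)"

definition arc_supersolution :: "(real \<Rightarrow> real \<Rightarrow> real) \<Rightarrow> real \<Rightarrow> (real \<Rightarrow> real) \<Rightarrow> bool" where
  "arc_supersolution h a u \<longleftrightarrow>
     (\<forall>s\<in>{0<..<1}. \<forall>\<phi>. subtangent \<phi> u s \<longrightarrow> h s (deriv \<phi> s) \<ge> a)"

definition subsolution ::
  "(real \<Rightarrow> real ^ 'n) set \<Rightarrow> ((real \<Rightarrow> real ^ 'n) \<Rightarrow> real \<Rightarrow> real \<Rightarrow> real) \<Rightarrow> real \<Rightarrow>
   (real ^ 'n \<Rightarrow> real) \<Rightarrow> bool" where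
  "subsolution \<E> H a w \<longleftrightarrow> continuous_on (network_space \<E>) w \<and>
     (\<forall>\<gamma>\<in>\<E>. arc_subsolution (H \<gamma>) a (w \<circ> \<gamma>))"

definition supersolution ::
  "(real \<Rightarrow> real ^ 'n) set \<Rightarrow> ((real \<Rightarrow> real ^ 'n) \<Rightarrow> real \<Rightarrow> real \<Rightarrow> real) \<Rightarrow> real \<Rightarrow>
   (real ^ 'n \<Rightarrow> real) \<Rightarrow> bool" where
  "supersolution \<E> H a v \<longleftrightarrow> continuous_on (network_space \<E>) v \<and>
     (\<forall>\<gamma>\<in>\<E>. arc_supersolution (H \<gamma>) a (v \<circ> \<gamma>)) \<and>
     (\<forall>x\<in>vertices \<E>. \<exists>\<gamma>\<in>arcs_into \<E> x.
        \<forall>\<phi>. constrained_subtangent \<phi> (v \<circ> \<gamma>) 1 \<longrightarrow> H \<gamma> 1 (deriv \<phi> 1) \<ge> a)"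

definition solution ::
  "(real \<Rightarrow> real ^ 'n) set \<Rightarrow> ((real \<Rightarrow> real ^ 'n) \<Rightarrow> real \<Rightarrow> real \<Rightarrow> real) \<Rightarrow> real \<Rightarrow>
   (real ^ 'n \<Rightarrow> real) \<Rightarrow> bool" where
  "solution \<E> H a u \<longleftrightarrow> subsolution \<E> H a u \<and> supersolution \<E> H a u"

text \<open>
  For \<open>\<gamma> \<in> \<E>\<close> the infimum and the supremum below are attained, by coercivity and continuity
  of \<open>H \<gamma>\<close> and compactness of \<open>[0,1]\<close>, so they are the minimum and the maximum.
\<close>

definition arc_value :: "(real \<Rightarrow> real \<Rightarrow> real) \<Rightarrow> real" where
  "arc_value h = (SUP s\<in>{0..1}. INF \<mu>. h s \<mu>)"

definition max_arc_value ::
  "(real \<Rightarrow> real ^ 'n) set \<Rightarrow> ((real \<Rightarrow> real ^ 'n) \<Rightarrow> real \<Rightarrow> real \<Rightarrow> real) \<Rightarrow> real" where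
  "max_arc_value \<E> H = (MAX \<gamma>\<in>\<E>. arc_value (H \<gamma>))"

text \<open>
  The set below is bounded below by \<open>max_arc_value \<E> H\<close>, and it is nonempty since a constant
  function is a subsolution for large \<open>a\<close>; so the real-valued \<^const>\<open>Inf\<close> is the
  genuine infimum.
\<close>

definition critical_value ::
  "(real \<Rightarrow> real ^ 'n) set \<Rightarrow> ((real \<Rightarrow> real ^ 'n) \<Rightarrow> real \<Rightarrow> real \<Rightarrow> real) \<Rightarrow> real" where
  "critical_value \<E> H = Inf {a. a \<ge> max_arc_value \<E> H \<and> (\<exists>w. subsolution \<E> H a w)}"

end

theory Submission imports Defs begin

text \<open>
  Two facts about a level \<open>b\<close> that admits a subsolution \<open>w\<close> carry the proof.

  On the one hand, \<open>b \<ge> a\<^sub>0\<close>: a continuous function on an interval has supertangents at points of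
  every open subinterval, so \<open>min H \<gamma> s \<le> b\<close> for \<open>s\<close> in a dense set, hence, by
  continuity and coercivity, for all \<open>s\<close>
  (\<open>arc_subsolution_imp_sublevel_nonempty\<close>). Therefore a level \<open>a\<close> that admits a solution belongs
  to the set whose infimum is the critical value \<open>c\<close>, and \<open>c \<le> a\<close>.

  On the other hand, no supersolution \<open>v\<close> exists at a level \<open>a > b\<close>. Pick \<open>m\<close> strictly between
  \<open>b\<close> and \<open>a\<close>. On each arc the larger root \<open>\<sigma> s\<close> of \<open>H \<gamma> s \<mu> = m\<close> depends continuously on \<open>s\<close>
  (\<open>right_root_continuous\<close>), so it has a \<open>C\<^sup>1\<close> antiderivative \<open>\<psi>\<close>. Slopes \<open>\<ge> \<sigma>\<close> are
  forbidden for supertangents of \<open>w \<circ> \<gamma>\<close>, whence the increment of \<open>w \<circ> \<gamma>\<close> along the arc is at most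
  that of \<open>\<psi>\<close> (\<open>arc_subsolution_increment_le\<close>). The slope \<open>\<sigma>\<close> is forbidden for subtangents of
  \<open>v \<circ> \<gamma>\<close>, so \<open>v \<circ> \<gamma> - \<psi>\<close> is minimal over \<open>[0,1]\<close> neither inside nor, if \<open>\<gamma>\<close> is the arc which
  the supersolution condition provides at its final vertex, at \<open>1\<close>; hence the increment of
  \<open>v \<circ> \<gamma>\<close> is strictly larger than that of \<open>\<psi>\<close> (\<open>arc_supersolution_increment_gt\<close>). So every
  vertex \<open>x\<close> is the end of an arc at whose initial vertex \<open>v - w\<close> is strictly smaller than at \<open>x\<close>,
  which is absurd if \<open>x\<close> minimizes \<open>v - w\<close> over the finite set of vertices.
\<close>

section \<open>Hamiltonians on a single arc\<close>

text \<open>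
  The conditions on the Hamiltonian of one arc, as a function of the parameter \<open>s\<close> and the slope
  \<open>\<mu>\<close>. Nothing is assumed for \<open>s\<close> outside \<open>[0,1]\<close>, and coercivity is pointwise in \<open>s\<close>.
\<close>

locale arc_hamiltonian =
  fixes h :: "real \<Rightarrow> real \<Rightarrow> real"
  assumes continuous_h: "continuous_on ({0..1} \<times> UNIV) (\<lambda>(s, \<mu>). h s \<mu>)"
    and coercive: "s \<in> {0..1} \<Longrightarrow> filterlim (h s) at_top at_infinity"
    and strictly_quasiconvex:
      "s \<in> {0..1} \<Longrightarrow> \<mu> \<noteq> \<mu>' \<Longrightarrow> \<rho> \<in> {0<..<1} \<Longrightarrow>
        h s (\<rho> * \<mu> + (1 - \<rho>) * \<mu>') < max (h s \<mu>) (h s \<mu>')"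
begin

lemma continuous_in_slope:
  assumes "s \<in> {0..1}"
  shows "continuous_on A (h s)"
proof -
  have "continuous_on A (\<lambda>\<mu>. (\<lambda>(s, \<mu>). h s \<mu>) (s, \<mu>))"
    by (rule continuous_on_compose2[OF continuous_h])
      (use assms in \<open>auto intro!: continuous_intros\<close>)
  then show ?thesis by simp
qed

lemma continuous_in_parameter: "continuous_on {0..1} (\<lambda>s. h s \<mu>)"
proof -
  have "continuous_on {0..1} (\<lambda>s. (\<lambda>(s, \<mu>). h s \<mu>) (s, \<mu>))"
    by (rule continuous_on_compose2[OF continuous_h]) (auto intro!: continuous_intros)
  then show ?thesis by simp
qed

lemma eventually_less_in_parameter:
  assumes "s \<in> {0..1}" "h s \<mu> < h s \<nu>"
  shows "\<forall>\<^sub>F t in at s within {0..1}. h t \<mu> < h t \<nu>"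
proof -
  have "((\<lambda>t. h t \<nu> - h t \<mu>) \<longlongrightarrow> h s \<nu> - h s \<mu>) (at s within {0..1})"
    using continuous_in_parameter assms(1)
    by (intro tendsto_diff) (auto simp: continuous_on_def)
  from order_tendstoD(1)[OF this, of 0] assms(2) show ?thesis by simp
qed

lemma less_max_between:
  assumes "s \<in> {0..1}" "x < y" "y < z"
  shows "h s y < max (h s x) (h s z)"
proof -
  define \<rho> where "\<rho> = (z - y) / (z - x)"
  have "\<rho> \<in> {0<..<1}" using assms by (auto simp: \<rho>_def field_simps)
  moreover have "\<rho> * x + (1 - \<rho>) * z = y"
  proof -
    have "\<rho> * (z - x) = z - y" using assms by (simp add: \<rho>_def)
    then show ?thesis by (simp add: algebra_simps)
  qed
  ultimately show ?thesis
    using strictly_quasiconvex[of s x z \<rho>] assms by auto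
qed

lemma less_right_of:
  assumes "s \<in> {0..1}" "x < y" "y < z" "h s x \<le> h s y"
  shows "h s y < h s z"
  using less_max_between[OF assms(1-3)] assms(4) by auto

lemma less_left_of:
  assumes "s \<in> {0..1}" "x < y" "y < z" "h s z \<le> h s y"
  shows "h s y < h s x"
  using less_max_between[OF assms(1-3)] assms(4) by auto

lemma exceeds_at_both_ends:
  assumes "s \<in> {0..1}"
  shows "\<exists>B>0. \<forall>\<mu>. \<bar>\<mu>\<bar> \<ge> B \<longrightarrow> h s \<mu> > m"
proof -
  have "\<forall>\<^sub>F \<mu> in at_infinity. h s \<mu> > m"
    using coercive[OF assms] by (simp add: filterlim_at_top_dense)
  then obtain B where "\<forall>\<mu>. \<bar>\<mu>\<bar> \<ge> B \<longrightarrow> h s \<mu> > m"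
    unfolding eventually_at_infinity by auto
  then show ?thesis by (intro exI[of _ "max B 1"]) auto
qed

lemma minimizer_exists:
  assumes "s \<in> {0..1}"
  shows "\<exists>r. \<forall>\<mu>. h s r \<le> h s \<mu>"
proof -
  obtain B where B: "B > 0" "\<And>\<mu>. \<bar>\<mu>\<bar> \<ge> B \<Longrightarrow> h s \<mu> > h s 0"
    using exceeds_at_both_ends[OF assms] by blast
  obtain r where r: "r \<in> {-B..B}" "\<And>\<mu>. \<mu> \<in> {-B..B} \<Longrightarrow> h s r \<le> h s \<mu>"
    using continuous_attains_inf[of "{-B..B}" "h s"] continuous_in_slope[OF assms] B(1) by auto
  have "h s r \<le> h s \<mu>" for \<mu>
    using r(2)[of \<mu>] r(2)[of 0] B(1) B(2)[of \<mu>] by (cases "\<mu> \<in> {-B..B}") force+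
  then show ?thesis by blast
qed

text \<open>
  The point is the uniformity in \<open>\<mu>\<close>. Near a minimizer \<open>r\<close> of \<open>h s\<close> it is compactness; farther
  away, quasiconvexity propagates the inequality \<open>h t r < h t (r \<plusminus> 1)\<close>, which is stable in \<open>t\<close>.
\<close>

lemma eventually_above_level:
  assumes s: "s \<in> {0..1}" and above: "\<And>\<mu>. h s \<mu> > a"
  shows "\<forall>\<^sub>F t in at s within {0..1}. \<forall>\<mu>. h t \<mu> > a"
proof -
  obtain r where r: "\<And>\<mu>. h s r \<le> h s \<mu>" using minimizer_exists[OF s] by blast
  have "h s r < h s (r + 1)" "h s r < h s (r - 1)"
    using less_max_between[OF s, of r "r + 1/2" "r + 1"] r[of "r + 1/2"]
      less_max_between[OF s, of "r - 1" "r - 1/2" r] r[of "r - 1/2"] by auto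
  note outer = eventually_less_in_parameter[OF s this(1)] eventually_less_in_parameter[OF s this(2)]
  define K where "K = {0..1::real} \<times> {r - 1..r + 1}"
  have "uniformly_continuous_on K (\<lambda>(s, \<mu>). h s \<mu>)"
    by (intro compact_uniformly_continuous continuous_on_subset[OF continuous_h])
      (auto simp: K_def compact_Times)
  then obtain d where d: "d > 0"
    "\<And>p q. p \<in> K \<Longrightarrow> q \<in> K \<Longrightarrow> dist q p < d \<Longrightarrow>
      dist ((\<lambda>(s, \<mu>). h s \<mu>) q) ((\<lambda>(s, \<mu>). h s \<mu>) p) < h s r - a"
    unfolding uniformly_continuous_on_def using above[of r] by (metis diff_gt_0_iff_gt)
  have "\<forall>\<^sub>F t in at s within {0..1}. t \<in> {0..1} \<and> dist t s < d"
    unfolding eventually_at using d(1) by auto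
  with outer show ?thesis
  proof eventually_elim
    case (elim t)
    have inner: "h t \<mu> > a" if "\<mu> \<in> {r - 1..r + 1}" for \<mu>
    proof -
      have "dist (h t \<mu>) (h s \<mu>) < h s r - a"
        using d(2)[of "(s, \<mu>)" "(t, \<mu>)"] that elim s by (auto simp: K_def dist_Pair_Pair)
      then show ?thesis using r[of \<mu>] by (auto simp: dist_real_def)
    qed
    show ?case
    proof
      fix \<mu>
      consider "\<mu> < r - 1" | "\<mu> \<in> {r - 1..r + 1}" | "r + 1 < \<mu>" by force
      then show "h t \<mu> > a"
      proof cases
        case 1
        then show ?thesis using less_left_of[of t \<mu> "r - 1" r] elim inner[of "r - 1"] by auto
      next
        case 3
        then show ?thesis using less_right_of[of t r "r + 1" \<mu>] elim inner[of "r + 1"] by auto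
      qed (fact inner)
    qed
  qed
qed

subsection \<open>The right root at a level above the minimum\<close>

text \<open>
  \<open>right_root m s q\<close> says that \<open>q\<close> is the larger of the two slopes at which the
  quasiconvex function \<open>h s\<close> takes the value \<open>m\<close>, for \<open>m\<close> above its minimum: the
  root of \<open>h s = m\<close> that has points of the strict sublevel set on its left.
\<close>

definition right_root :: "real \<Rightarrow> real \<Rightarrow> real \<Rightarrow> bool" where
  "right_root m s q \<longleftrightarrow> h s q = m \<and> (\<exists>r<q. h s r < m)"

lemma right_root_less:
  assumes "s \<in> {0..1}" "right_root m s q" "q < p"
  shows "m < h s p"
  using assms less_right_of[of s _ q p] by (auto simp: right_root_def)

lemma right_root_unique:
  assumes "s \<in> {0..1}" "right_root m s q" "right_root m s q'"
  shows "q = q'"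
  using right_root_less[of s m q q'] right_root_less[of s m q' q] assms
  by (cases q q' rule: linorder_cases) (auto simp: right_root_def)

lemma right_root_between:
  assumes "s \<in> {0..1}" "h s l < m" "m < h s u" "l < u"
  shows "\<exists>q. l < q \<and> q < u \<and> right_root m s q"
proof -
  obtain q where "l \<le> q" "q \<le> u" "h s q = m"
    using IVT'[of "h s" l m u] continuous_in_slope[OF assms(1)] assms by auto
  moreover from this have "q \<noteq> l" "q \<noteq> u" using assms by auto
  ultimately have "l < q" "q < u" "right_root m s q"
    using assms(2) by (auto simp: right_root_def intro!: exI[of _ l])
  then show ?thesis by blast
qed

lemma right_root_exists:
  assumes "s \<in> {0..1}" "h s r < m"
  shows "\<exists>q. right_root m s q"
proof -
  obtain B where B: "B > 0" "\<And>\<mu>. \<bar>\<mu>\<bar> \<ge> B \<Longrightarrow> h s \<mu> > m"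
    using exceeds_at_both_ends[OF assms(1)] by blast
  then show ?thesis
    using right_root_between[of s r m "max B (r + 1)"] assms by fastforce
qed

lemma right_root_continuous:
  assumes root: "\<And>s. s \<in> {0..1} \<Longrightarrow> right_root m s (\<sigma> s)"
  shows "continuous_on {0..1} \<sigma>"
  unfolding continuous_on_def tendsto_iff
proof (intro ballI allI impI)
  fix s e :: real
  assume s: "s \<in> {0..1}" and e: "e > 0"
  obtain r where r: "r < \<sigma> s" "h s r < m" "h s (\<sigma> s) = m"
    using root[OF s] by (auto simp: right_root_def)
  obtain l where l: "r < l" "\<sigma> s - e < l" "l < \<sigma> s"
    using dense[of "max r (\<sigma> s - e)" "\<sigma> s"] r(1) e by auto
  have "h s l < m" using less_max_between[OF s l(1) l(3)] r by auto
  moreover have "m < h s (\<sigma> s + e)" using right_root_less[OF s root[OF s]] e by simp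
  moreover have lim: "((\<lambda>t. h t \<mu>) \<longlongrightarrow> h s \<mu>) (at s within {0..1})" for \<mu>
    using continuous_in_parameter s by (auto simp: continuous_on_def)
  ultimately have "\<forall>\<^sub>F t in at s within {0..1}. h t l < m"
      "\<forall>\<^sub>F t in at s within {0..1}. m < h t (\<sigma> s + e)"
    using order_tendstoD(2)[OF lim[of l], of m] order_tendstoD(1)[OF lim[of "\<sigma> s + e"], of m]
    by auto
  moreover have "\<forall>\<^sub>F t in at s within {0..1}. t \<in> {0..1}"
    by (simp add: eventually_at_filter)
  ultimately show "\<forall>\<^sub>F t in at s within {0..1}. dist (\<sigma> t) (\<sigma> s) < e"
  proof eventually_elim
    case (elim t)
    then obtain q where "l < q" "q < \<sigma> s + e" "right_root m t q"
      using right_root_between[of t l m "\<sigma> s + e"] l e by auto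
    then show ?case
      using right_root_unique[of t m q "\<sigma> t"] root[of t] elim l by (auto simp: dist_real_def)
  qed
qed

end

section \<open>Touching at interior extrema\<close>

lemma supertangent_interior_maximum:
  assumes "\<phi> C1_differentiable_on UNIV" "s \<in> {l<..<r}"
    and "\<And>t. t \<in> {l..r} \<Longrightarrow> u t - \<phi> t \<le> u s - \<phi> s"
  shows "supertangent \<phi> u s"
proof -
  have "\<forall>\<^sub>F t in nhds s. t \<in> {l<..<r}"
    using assms(2) by (intro eventually_nhds_in_open) auto
  then show ?thesis
    unfolding supertangent_def using assms(1,3) by (auto elim!: eventually_mono)
qed

lemma subtangent_interior_minimum:
  assumes "\<phi> C1_differentiable_on UNIV" "s \<in> {l<..<r}"
    and "\<And>t. t \<in> {l..r} \<Longrightarrow> u s - \<phi> s \<le> u t - \<phi> t"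
  shows "subtangent \<phi> u s"
proof -
  have "\<forall>\<^sub>F t in nhds s. t \<in> {l<..<r}"
    using assms(2) by (intro eventually_nhds_in_open) auto
  then show ?thesis
    unfolding subtangent_def using assms(1,3) by (auto elim!: eventually_mono)
qed

lemma C1_differentiable_on_UNIV_if_continuous_derivative:
  fixes \<phi> g :: "real \<Rightarrow> real"
  assumes "\<And>t. (\<phi> has_real_derivative g t) (at t)" "continuous_on UNIV g"
  shows "\<phi> C1_differentiable_on UNIV"
  unfolding C1_differentiable_on_def
  using assms by (auto simp: has_real_derivative_iff_has_vector_derivative)

lemma continuous_on_if_has_real_derivative:
  fixes \<phi> g :: "real \<Rightarrow> real"
  assumes "\<And>t. (\<phi> has_real_derivative g t) (at t)"
  shows "continuous_on A \<phi>"
  by (meson assms DERIV_isCont continuous_at_imp_continuous_on)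

lemma supertangent_exists:
  fixes u :: "real \<Rightarrow> real"
  assumes cont: "continuous_on {l..r} u" and "l < r"
  shows "\<exists>s\<in>{l<..<r}. \<exists>\<phi>. supertangent \<phi> u s"
proof -
  \<comment> \<open>A parabola that rises from the midpoint \<open>c\<close> to more than the oscillation of \<open>u\<close> at both ends.\<close>
  define c where "c = (l + r) / 2"
  have "bounded (u ` {l..r})"
    by (intro compact_imp_bounded compact_continuous_image cont compact_Icc)
  then obtain K where K: "\<And>t. t \<in> {l..r} \<Longrightarrow> \<bar>u t\<bar> \<le> K"
    unfolding bounded_iff by (metis imageI real_norm_def)
  define k where "k = (2 * K + 1) / ((r - l) / 2)\<^sup>2"
  define \<phi> where "\<phi> = (\<lambda>t. k * (t - c)\<^sup>2)"
  have deriv: "(\<phi> has_real_derivative 2 * k * (t - c)) (at t)" for t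
    unfolding \<phi>_def by (auto intro!: derivative_eq_intros)
  have C1: "\<phi> C1_differentiable_on UNIV"
    by (rule C1_differentiable_on_UNIV_if_continuous_derivative[OF deriv])
      (intro continuous_intros)
  have "continuous_on {l..r} (\<lambda>t. u t - \<phi> t)"
    by (intro continuous_intros cont continuous_on_if_has_real_derivative[OF deriv])
  then obtain s where s: "s \<in> {l..r}" "\<And>t. t \<in> {l..r} \<Longrightarrow> u t - \<phi> t \<le> u s - \<phi> s"
    using continuous_attains_sup[of "{l..r}" "\<lambda>t. u t - \<phi> t"] assms(2) by auto
  have c: "c \<in> {l..r}" "\<phi> c = 0" using assms(2) by (auto simp: c_def \<phi>_def)
  have "\<phi> l = 2 * K + 1" "\<phi> r = 2 * K + 1"
  proof -
    have "(l - c)\<^sup>2 = ((r - l) / 2)\<^sup>2" "(r - c)\<^sup>2 = ((r - l) / 2)\<^sup>2"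
      by (auto simp: c_def power2_eq_square field_simps)
    moreover have "k * ((r - l) / 2)\<^sup>2 = 2 * K + 1" using assms(2) by (simp add: k_def)
    ultimately show "\<phi> l = 2 * K + 1" "\<phi> r = 2 * K + 1" by (simp_all only: \<phi>_def)
  qed
  then have "s \<noteq> l" "s \<noteq> r"
    using s(2)[OF c(1)] c(2) K[OF c(1)] K[of l] K[of r] assms(2) by auto
  then have "s \<in> {l<..<r}" using s(1) by auto
  with supertangent_interior_maximum[OF C1 this, of u] s(2) show ?thesis by blast
qed

section \<open>Subsolutions and supersolutions on a single arc\<close>

context arc_hamiltonian
begin

lemma arc_subsolution_imp_sublevel_nonempty:
  assumes sub: "arc_subsolution h a u" and cont: "continuous_on {0..1} u"
    and s: "s \<in> {0..1}"
  shows "\<exists>r. h s r \<le> a"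
proof (rule ccontr)
  assume "\<nexists>r. h s r \<le> a"
  then have above: "\<And>\<mu>. h s \<mu> > a" by (simp add: not_le)
  obtain d where d: "d > 0"
    "\<And>t. t \<in> {0..1} \<Longrightarrow> t \<noteq> s \<Longrightarrow> dist t s < d \<Longrightarrow> \<forall>\<mu>. h t \<mu> > a"
    using eventually_above_level[OF s above] unfolding eventually_at by auto
  define l where "l = max 0 (s - d)"
  define r where "r = min 1 (s + d)"
  have lr: "l < r" "0 \<le> l" "r \<le> 1" using s d(1) by (auto simp: l_def r_def)
  then obtain t \<phi> where t: "t \<in> {l<..<r}" "supertangent \<phi> u t"
    using supertangent_exists[of l r u] continuous_on_subset[OF cont, of "{l..r}"] by auto
  have "h t (deriv \<phi> t) \<le> a" using sub t lr by (auto simp: arc_subsolution_def)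
  moreover have "h t (deriv \<phi> t) > a"
    using d(2)[of t] above t lr
    by (cases "t = s") (auto simp: l_def r_def dist_real_def abs_less_iff)
  ultimately show False by simp
qed

lemma arc_value_le:
  assumes "\<And>s. s \<in> {0..1} \<Longrightarrow> \<exists>r. h s r \<le> a"
  shows "arc_value h \<le> a"
  unfolding arc_value_def
proof (rule cSUP_least)
  fix s :: real assume s: "s \<in> {0..1}"
  obtain r where "h s r \<le> a" using assms[OF s] by blast
  moreover have "bdd_below (range (h s))"
    using minimizer_exists[OF s] unfolding bdd_below_def by blast
  then have "(INF \<mu>. h s \<mu>) \<le> h s r" by (intro cINF_lower) auto
  ultimately show "(INF \<mu>. h s \<mu>) \<le> a" by simp
qed simp

text \<open>
  If the increment of \<open>u\<close> exceeded that of \<open>\<psi>\<close>, then adding to \<open>\<psi>\<close> a steep increasing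
  function concentrated near \<open>1\<close> would force \<open>u - \<psi>\<close> to a maximum inside \<open>(0,1)\<close>; there the slope
  of the resulting supertangent is at least \<open>g\<close>.
\<close>

lemma arc_subsolution_increment_le:
  assumes sub: "arc_subsolution h b u" and cont: "continuous_on {0..1} u"
    and deriv: "\<And>t. (\<psi> has_real_derivative g t) (at t)" and g: "continuous_on UNIV g"
    and above: "\<And>s p. s \<in> {0..1} \<Longrightarrow> g s \<le> p \<Longrightarrow> h s p > b"
  shows "u 1 - u 0 \<le> \<psi> 1 - \<psi> 0"
proof (rule ccontr)
  assume increment: "\<not> ?thesis"
  define f where "f t = u t - \<psi> t" for t
  have f: "f 0 < f 1" using increment by (simp add: f_def)
  have contf: "continuous_on {0..1} f"
    unfolding f_def
    by (intro continuous_intros cont continuous_on_if_has_real_derivative[OF deriv])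
  obtain t1 where t1: "0 < t1" "t1 < 1" "f 0 < f t1"
  proof -
    have "(f \<longlongrightarrow> f 1) (at 1 within {0..1})" using contf by (auto simp: continuous_on_def)
    from order_tendstoD(1)[OF this f]
    obtain d where d: "d > 0" "\<And>t. t \<in> {0..1} \<Longrightarrow> t \<noteq> 1 \<Longrightarrow> dist t 1 < d \<Longrightarrow> f 0 < f t"
      unfolding eventually_at by auto
    have "f 0 < f (max (1/2) (1 - d/2))"
      by (rule d(2)) (use d(1) in \<open>auto simp: dist_real_def\<close>)
    then show ?thesis using that[of "max (1/2) (1 - d/2)"] d(1) by auto
  qed
  \<comment> \<open>The monomial \<open>M * t ^ Suc n\<close> exceeds \<open>f 1 - f 0\<close> at \<open>1\<close> but stays below
    \<open>f t1 - f 0\<close> at \<open>t1\<close>; a positive exponent makes it vanish at \<open>0\<close>.\<close>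
  define M where "M = f 1 - f 0 + 1"
  have M: "M > 0" using f by (simp add: M_def)
  obtain n where n: "t1 ^ n < (f t1 - f 0) / M"
    using real_arch_pow_inv[of "(f t1 - f 0) / M" t1] t1 M by auto
  define \<phi> where "\<phi> = (\<lambda>t. \<psi> t + M * t ^ Suc n)"
  define g' where "g' = (\<lambda>t. g t + M * (real (Suc n) * t ^ n))"
  have deriv': "(\<phi> has_real_derivative g' t) (at t)" for t
    unfolding \<phi>_def g'_def by (rule derivative_eq_intros deriv refl | simp)+
  have C1: "\<phi> C1_differentiable_on UNIV"
    by (rule C1_differentiable_on_UNIV_if_continuous_derivative[OF deriv'])
      (auto simp: g'_def intro!: continuous_intros g)
  have "continuous_on {0..1} (\<lambda>t. u t - \<phi> t)"
    by (intro continuous_intros cont continuous_on_if_has_real_derivative[OF deriv'])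
  then obtain s where s: "s \<in> {0..1}" "\<And>t. t \<in> {0..1} \<Longrightarrow> u t - \<phi> t \<le> u s - \<phi> s"
    using continuous_attains_sup[of "{0..1}" "\<lambda>t. u t - \<phi> t"] by auto
  have eq: "u t - \<phi> t = f t - M * t ^ Suc n" for t by (simp add: \<phi>_def f_def)
  have "f t1 - M * t1 ^ Suc n > f 0"
  proof -
    have "t1 ^ Suc n \<le> t1 ^ n" using t1 by (simp add: mult_le_cancel_right1)
    with n have "t1 ^ Suc n < (f t1 - f 0) / M" by simp
    then show ?thesis using M by (simp add: field_simps)
  qed
  with s(2)[of t1] t1 have "f s - M * s ^ Suc n > f 0" by (simp add: eq)
  then have "s \<noteq> 0" "s \<noteq> 1" by (auto simp: M_def)
  with s(1) have s01: "s \<in> {0<..<1}" by auto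
  have "h s (deriv \<phi> s) \<le> b"
    using sub supertangent_interior_maximum[OF C1 s01, of u] s(2) s01
    by (auto simp: arc_subsolution_def)
  moreover have "g s \<le> deriv \<phi> s"
    using DERIV_imp_deriv[OF deriv', of s] M s01 by (simp add: g'_def)
  ultimately show False using above[of s "deriv \<phi> s"] s(1) by simp
qed

lemma arc_supersolution_increment_gt:
  assumes super: "arc_supersolution h a v" and cont: "continuous_on {0..1} v"
    and end1: "\<And>\<phi>. constrained_subtangent \<phi> v 1 \<Longrightarrow> h 1 (deriv \<phi> 1) \<ge> a"
    and deriv: "\<And>t. (\<psi> has_real_derivative g t) (at t)" and g: "continuous_on UNIV g"
    and below: "\<And>s. s \<in> {0..1} \<Longrightarrow> h s (g s) < a"
  shows "\<psi> 1 - \<psi> 0 < v 1 - v 0"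
proof (rule ccontr)
  assume "\<not> ?thesis"
  then have le: "v 1 - \<psi> 1 \<le> v 0 - \<psi> 0" by simp
  have C1: "\<psi> C1_differentiable_on UNIV"
    by (rule C1_differentiable_on_UNIV_if_continuous_derivative[OF deriv g])
  have "continuous_on {0..1} (\<lambda>t. v t - \<psi> t)"
    by (intro continuous_intros cont continuous_on_if_has_real_derivative[OF deriv])
  then obtain s' where s': "s' \<in> {0..1}" "\<And>t. t \<in> {0..1} \<Longrightarrow> v s' - \<psi> s' \<le> v t - \<psi> t"
    using continuous_attains_inf[of "{0..1}" "\<lambda>t. v t - \<psi> t"] by auto
  \<comment> \<open>If the minimum is attained at \<open>0\<close>, then, by \<open>le\<close>, it is attained at \<open>1\<close> too.\<close>
  define s where "s = (if s' = 0 then 1 else s')"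
  have s: "s \<in> {0<..1}" "\<And>t. t \<in> {0..1} \<Longrightarrow> v s - \<psi> s \<le> v t - \<psi> t"
    using s' le by (fastforce simp: s_def)+
  have "h s (deriv \<psi> s) \<ge> a"
  proof (cases "s = 1")
    case True
    have "constrained_subtangent \<psi> v 1"
      using C1 s(2) True by (auto simp: constrained_subtangent_def)
    then show ?thesis using end1 True by simp
  next
    case False
    then have "s \<in> {0<..<1}" using s(1) by auto
    then show ?thesis
      using super subtangent_interior_minimum[OF C1, of s 0 1 v] s(2)
      by (auto simp: arc_supersolution_def)
  qed
  then show False using below[of s] s(1) DERIV_imp_deriv[OF deriv, of s] by auto
qed

lemma increment_sub_less_increment_super:
  assumes sub: "arc_subsolution h b w" "continuous_on {0..1} w"
    and super: "arc_supersolution h a v" "continuous_on {0..1} v"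
    and end1: "\<And>\<phi>. constrained_subtangent \<phi> v 1 \<Longrightarrow> h 1 (deriv \<phi> 1) \<ge> a"
    and "b < a"
  shows "w 1 - w 0 < v 1 - v 0"
proof -
  define m where "m = (a + b) / 2"
  have m: "b < m" "m < a" using \<open>b < a\<close> by (auto simp: m_def)
  have "\<exists>q. right_root m s q" if "s \<in> {0..1}" for s
    using arc_subsolution_imp_sublevel_nonempty[OF sub that] right_root_exists[OF that] m(1)
    by (meson le_less_trans)
  then obtain \<sigma> where root: "\<And>s. s \<in> {0..1} \<Longrightarrow> right_root m s (\<sigma> s)" by metis
  \<comment> \<open>Test functions live on the whole line, so \<open>\<sigma>\<close> is extended by its end values.\<close>
  define g where "g s = \<sigma> (max 0 (min 1 s))" for s
  have g: "continuous_on UNIV g"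
    unfolding g_def
    by (rule continuous_on_compose2[OF right_root_continuous[OF root]])
      (auto intro!: continuous_intros)
  have "\<exists>\<psi>. \<forall>t. - \<infinity> < ereal t \<longrightarrow> ereal t < \<infinity> \<longrightarrow> (\<psi> has_vector_derivative g t) (at t)"
    by (rule einterval_antiderivative) (use g in \<open>auto simp: continuous_on_eq_continuous_at\<close>)
  then obtain \<psi> where \<psi>: "\<And>t. (\<psi> has_real_derivative g t) (at t)"
    by (auto simp: has_real_derivative_iff_has_vector_derivative)
  have g_root: "right_root m s (g s)" if "s \<in> {0..1}" for s
    using root[OF that] that by (simp add: g_def)
  have "w 1 - w 0 \<le> \<psi> 1 - \<psi> 0"
  proof (rule arc_subsolution_increment_le[OF sub \<psi> g])
    fix s p :: real assume s: "s \<in> {0..1}" and "g s \<le> p"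
    then show "h s p > b"
      using right_root_less[OF s g_root[OF s], of p] g_root[OF s] m(1)
      by (cases "p = g s") (auto simp: right_root_def)
  qed
  also have "\<dots> < v 1 - v 0"
    using g_root m(2) by (intro arc_supersolution_increment_gt[OF super end1 \<psi> g])
      (auto simp: right_root_def)
  finally show ?thesis .
qed

end

section \<open>Levels on the network\<close>

lemma arc_hamiltonian_if_hamiltonian_on:
  assumes "hamiltonian_on \<E> H" "\<gamma> \<in> \<E>"
  shows "arc_hamiltonian (H \<gamma>)"
  using assms unfolding hamiltonian_on_def arc_hamiltonian_def by blast

lemma continuous_on_arc:
  assumes "embedded_network \<E>" "continuous_on (network_space \<E>) f" "\<gamma> \<in> \<E>"
  shows "continuous_on {0..1} (f \<circ> \<gamma>)"
proof (rule continuous_on_compose)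
  show "continuous_on {0..1} \<gamma>"
    using assms by (auto simp: embedded_network_def regular_arc_def simple_path_def path_def)
  show "continuous_on (\<gamma> ` {0..1}) f"
    using assms by (auto simp: network_space_def path_image_def intro: continuous_on_subset)
qed

lemma subsolution_imp_max_arc_value_le:
  assumes net: "embedded_network \<E>" and ham: "hamiltonian_on \<E> H" and sub: "subsolution \<E> H a w"
  shows "max_arc_value \<E> H \<le> a"
proof -
  have "arc_value (H \<gamma>) \<le> a" if \<gamma>: "\<gamma> \<in> \<E>" for \<gamma>
  proof -
    interpret arc_hamiltonian "H \<gamma>" by (rule arc_hamiltonian_if_hamiltonian_on[OF ham \<gamma>])
    have "arc_subsolution (H \<gamma>) a (w \<circ> \<gamma>)" "continuous_on {0..1} (w \<circ> \<gamma>)"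
      using sub continuous_on_arc[OF net _ \<gamma>] \<gamma> by (auto simp: subsolution_def)
    then show ?thesis
      by (intro arc_value_le arc_subsolution_imp_sublevel_nonempty)
  qed
  then show ?thesis
    using net by (auto simp: max_arc_value_def embedded_network_def)
qed

lemma supersolution_level_le_subsolution_level:
  assumes net: "embedded_network \<E>" and ham: "hamiltonian_on \<E> H"
    and sub: "subsolution \<E> H b w" and super: "supersolution \<E> H a v"
  shows "a \<le> b"
proof (rule ccontr)
  assume "\<not> a \<le> b"
  have "finite (vertices \<E>)" "vertices \<E> \<noteq> {}"
    using net by (auto simp: vertices_def embedded_network_def)
  then obtain x where x: "x \<in> vertices \<E>" "\<And>y. y \<in> vertices \<E> \<Longrightarrow> v x - w x \<le> v y - w y"
    using arg_min_if_finite[of "vertices \<E>" "\<lambda>x. v x - w x"] by (meson not_le)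
  then obtain \<gamma> where \<gamma>: "\<gamma> \<in> \<E>" "pathfinish \<gamma> = x"
    and end1: "\<And>\<phi>. constrained_subtangent \<phi> (v \<circ> \<gamma>) 1 \<Longrightarrow> H \<gamma> 1 (deriv \<phi> 1) \<ge> a"
    using super unfolding supersolution_def arcs_into_def by blast
  interpret arc_hamiltonian "H \<gamma>" by (rule arc_hamiltonian_if_hamiltonian_on[OF ham \<gamma>(1)])
  have on_arc: "arc_subsolution (H \<gamma>) b (w \<circ> \<gamma>)" "continuous_on {0..1} (w \<circ> \<gamma>)"
      "arc_supersolution (H \<gamma>) a (v \<circ> \<gamma>)" "continuous_on {0..1} (v \<circ> \<gamma>)"
    using sub super \<gamma>(1) continuous_on_arc[OF net _ \<gamma>(1)]
    by (auto simp: subsolution_def supersolution_def)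
  have "(w \<circ> \<gamma>) 1 - (w \<circ> \<gamma>) 0 < (v \<circ> \<gamma>) 1 - (v \<circ> \<gamma>) 0"
    using increment_sub_less_increment_super[OF on_arc end1] \<open>\<not> a \<le> b\<close> by simp
  moreover have "pathstart \<gamma> \<in> vertices \<E>" using \<gamma>(1) by (auto simp: vertices_def)
  ultimately show False
    using x(2)[of "pathstart \<gamma>"] \<gamma>(2) by (simp add: pathstart_def pathfinish_def)
qed

theorem corollary4p9:
  fixes \<E> :: "(real \<Rightarrow> real ^ 'n) set"
    and H :: "(real \<Rightarrow> real ^ 'n) \<Rightarrow> real \<Rightarrow> real \<Rightarrow> real"
    and a :: real
  assumes "embedded_network \<E>"
    and "hamiltonian_on \<E> H"
    and "\<exists>u. solution \<E> H a u"
  shows "a = critical_value \<E> H"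
proof -
  obtain u where u: "subsolution \<E> H a u" "supersolution \<E> H a u"
    using assms(3) by (auto simp: solution_def)
  let ?L = "{b. b \<ge> max_arc_value \<E> H \<and> (\<exists>w. subsolution \<E> H b w)}"
  have "a \<in> ?L"
    using u(1) subsolution_imp_max_arc_value_le[OF assms(1,2)] by blast
  then have "Inf ?L = a"
    by (rule cInf_eq_minimum)
      (use u(2) supersolution_level_le_subsolution_level[OF assms(1,2)] in blast)
  then show ?thesis by (simp add: critical_value_def)
qed

end
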